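(* Let $C$ be a category such that for every object $X$ of $C$ the countably infinite coproduct $\coprod_{\mathbb{N}}X$ (of copies of $X$ indexed by $\mathbb{N}$) exists in $C$. Let $F\colon C\to\mathsf{Ab}$ be a contravariant functor to the category of Abelian groups such that for all objects $X$ of $C$ the structure maps $X\to\coprod_{\mathbb{N}}X$ of the summands induce an isomorphism $$\varphi_X\colon F\Bigl(\coprod_{\mathbb{N}}X\Bigr)\longrightarrow\prod_{\mathbb{N}}F(X).$$ Then every finite homogeneous functorial semi-norm on $F$ is trivial.
   Context: A finite semi-norm on an Abelian group $A$ is a map $|\cdot| \colon A \to \mathbb{R}_{\ge 0}$ with $|0|=0$, $|-x|=|x|$ and $|x+y|\le |x|+|y|$ for all $x,y\in A$. It is homogeneous if $|n\cdot x| = |n|\cdot|x|$ for all $n\in\mathbb{Z}\setminus\{0\}$ and all $x\in A$. A finite functorial semi-norm on a contravariant functor $F\colon C\to\mathsf{Ab}$ is a choice of a finite semi-norm $|\cdot|$ on $F(X)$ for every object $X$ of $C$ such that $|F(f)(\alpha)|\le|\alpha|$ for all morphisms $f\colon X\to Y$ in $C$ and all $\alpha\in F(Y)$. It is homogeneous if all these semi-norms are homogeneous, and it is trivial if $|\alpha|=0$ for all objects $X$ of $C$ and all $\alpha\in F(X)$. The map $\varphi_X$ is $\beta\mapsto (F(f_d)(\beta))_{d\in\mathbb{N}}$, where $f_d\colon X\to\coprod_{\mathbb{N}}X$ is the structure map of the $d$-th summand. *)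

theory Defs
  imports Complex_Main "HOL-Algebra.Product_Groups"
begin

text \<open>\<open>Comp C g f\<close> is "g after f"; it is only meaningful when \<open>Cod C f = Dom C g\<close>.\<close>

record ('o, 'm) category_data =
  Obj :: "'o set"
  Arr :: "'m set"
  Dom :: "'m \<Rightarrow> 'o"
  Cod :: "'m \<Rightarrow> 'o"
  Ident :: "'o \<Rightarrow> 'm"
  Comp :: "'m \<Rightarrow> 'm \<Rightarrow> 'm"

definition Hom :: "('o, 'm) category_data \<Rightarrow> 'o \<Rightarrow> 'o \<Rightarrow> 'm set" where
  "Hom C X Y = {f \<in> Arr C. Dom C f = X \<and> Cod C f = Y}"

locale category =
  fixes C :: "('o, 'm) category_data"
  assumes Dom_in_Obj: "f \<in> Arr C \<Longrightarrow> Dom C f \<in> Obj C"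
    and Cod_in_Obj: "f \<in> Arr C \<Longrightarrow> Cod C f \<in> Obj C"
    and Ident_in_Hom: "X \<in> Obj C \<Longrightarrow> Ident C X \<in> Hom C X X"
    and Comp_in_Hom: "f \<in> Hom C X Y \<Longrightarrow> g \<in> Hom C Y Z \<Longrightarrow> Comp C g f \<in> Hom C X Z"
    and Comp_Ident_left: "f \<in> Hom C X Y \<Longrightarrow> Comp C (Ident C Y) f = f"
    and Comp_Ident_right: "f \<in> Hom C X Y \<Longrightarrow> Comp C f (Ident C X) = f"
    and Comp_assoc: "f \<in> Hom C W X \<Longrightarrow> g \<in> Hom C X Y \<Longrightarrow> h \<in> Hom C Y Z \<Longrightarrow>
      Comp C (Comp C h g) f = Comp C h (Comp C g f)"

definition is_coproduct ::
  "('o, 'm) category_data \<Rightarrow> 'i set \<Rightarrow> ('i \<Rightarrow> 'o) \<Rightarrow> 'o \<Rightarrow> ('i \<Rightarrow> 'm) \<Rightarrow> bool" where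
  "is_coproduct C I A S \<iota> \<longleftrightarrow>
     S \<in> Obj C \<and> (\<forall>i\<in>I. A i \<in> Obj C \<and> \<iota> i \<in> Hom C (A i) S) \<and>
     (\<forall>Y\<in>Obj C. \<forall>f. (\<forall>i\<in>I. f i \<in> Hom C (A i) Y) \<longrightarrow>
        (\<exists>!h. h \<in> Hom C S Y \<and> (\<forall>i\<in>I. Comp C h (\<iota> i) = f i)))"

text \<open>
  Abelian groups are the multiplicatively written commutative groups of HOL-Algebra: \<open>\<otimes>\<close>,
  \<open>\<one>\<close>, \<open>inv x\<close> and \<open>x [^] n\<close> stand for addition, zero, \<open>- x\<close> and \<open>n \<cdot> x\<close>.
  The values of a functor are groups whose carriers are subsets of one common type, which is
  arbitrary.
\<close>

record ('o, 'm, 'a) ab_functor =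
  on_obj :: "'o \<Rightarrow> 'a monoid"
  on_arr :: "'m \<Rightarrow> 'a \<Rightarrow> 'a"

locale contravariant_functor_Ab = category C
  for C :: "('o, 'm) category_data" +
  fixes F :: "('o, 'm, 'a) ab_functor"
  assumes on_obj_comm_group: "X \<in> Obj C \<Longrightarrow> comm_group (on_obj F X)"
    and on_arr_hom: "f \<in> Hom C X Y \<Longrightarrow> on_arr F f \<in> hom (on_obj F Y) (on_obj F X)"
    and on_arr_Ident: "X \<in> Obj C \<Longrightarrow> \<alpha> \<in> carrier (on_obj F X) \<Longrightarrow>
      on_arr F (Ident C X) \<alpha> = \<alpha>"
    and on_arr_Comp: "f \<in> Hom C X Y \<Longrightarrow> g \<in> Hom C Y Z \<Longrightarrow> \<alpha> \<in> carrier (on_obj F Z) \<Longrightarrow>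
      on_arr F (Comp C g f) \<alpha> = on_arr F f (on_arr F g \<alpha>)"

definition finite_seminorm :: "'a monoid \<Rightarrow> ('a \<Rightarrow> real) \<Rightarrow> bool" where
  "finite_seminorm A N \<longleftrightarrow>
     (\<forall>x\<in>carrier A. 0 \<le> N x) \<and>
     N \<one>\<^bsub>A\<^esub> = 0 \<and>
     (\<forall>x\<in>carrier A. N (inv\<^bsub>A\<^esub> x) = N x) \<and>
     (\<forall>x\<in>carrier A. \<forall>y\<in>carrier A. N (x \<otimes>\<^bsub>A\<^esub> y) \<le> N x + N y)"

definition homogeneous_seminorm :: "'a monoid \<Rightarrow> ('a \<Rightarrow> real) \<Rightarrow> bool" where
  "homogeneous_seminorm A N \<longleftrightarrow>
     (\<forall>n::int. n \<noteq> 0 \<longrightarrow> (\<forall>x\<in>carrier A. N (x [^]\<^bsub>A\<^esub> n) = real_of_int \<bar>n\<bar> * N x))"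

definition finite_functorial_seminorm ::
  "('o, 'm) category_data \<Rightarrow> ('o, 'm, 'a) ab_functor \<Rightarrow> ('o \<Rightarrow> 'a \<Rightarrow> real) \<Rightarrow> bool" where
  "finite_functorial_seminorm C F N \<longleftrightarrow>
     (\<forall>X\<in>Obj C. finite_seminorm (on_obj F X) (N X)) \<and>
     (\<forall>X\<in>Obj C. \<forall>Y\<in>Obj C. \<forall>f\<in>Hom C X Y. \<forall>\<alpha>\<in>carrier (on_obj F Y).
        N X (on_arr F f \<alpha>) \<le> N Y \<alpha>)"

definition homogeneous_functorial_seminorm ::
  "('o, 'm) category_data \<Rightarrow> ('o, 'm, 'a) ab_functor \<Rightarrow> ('o \<Rightarrow> 'a \<Rightarrow> real) \<Rightarrow> bool" where
  "homogeneous_functorial_seminorm C F N \<longleftrightarrow>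
     (\<forall>X\<in>Obj C. homogeneous_seminorm (on_obj F X) (N X))"

definition trivial_functorial_seminorm ::
  "('o, 'm) category_data \<Rightarrow> ('o, 'm, 'a) ab_functor \<Rightarrow> ('o \<Rightarrow> 'a \<Rightarrow> real) \<Rightarrow> bool" where
  "trivial_functorial_seminorm C F N \<longleftrightarrow>
     (\<forall>X\<in>Obj C. \<forall>\<alpha>\<in>carrier (on_obj F X). N X \<alpha> = 0)"

definition coproduct_comparison ::
  "('o, 'm, 'a) ab_functor \<Rightarrow> (nat \<Rightarrow> 'm) \<Rightarrow> 'a \<Rightarrow> (nat \<Rightarrow> 'a)" where
  "coproduct_comparison F \<iota> \<beta> = (\<lambda>d. on_arr F (\<iota> d) \<beta>)"

end

(* For \<alpha> \<in> F(X), some \<beta> \<in> F(\<Coprod> X) restricts to (d + 1) \<cdot> \<alpha> on the d-th summand. Functoriality and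
   homogeneity give (d + 1) |\<alpha>| \<le> |\<beta>| for every d, and |\<beta>| is finite, so |\<alpha>| = 0. *)
theory Submission
  imports Defs
begin

theorem corollary4p5:
  fixes C :: "('o, 'm) category_data"
    and F :: "('o, 'm, 'a) ab_functor"
    and coprod :: "'o \<Rightarrow> 'o"
    and incl :: "'o \<Rightarrow> nat \<Rightarrow> 'm"
    and N :: "'o \<Rightarrow> 'a \<Rightarrow> real"
  assumes "category C"
    and "\<And>X. X \<in> Obj C \<Longrightarrow> is_coproduct C (UNIV :: nat set) (\<lambda>_. X) (coprod X) (incl X)"
    and "contravariant_functor_Ab C F"
    and "\<And>X. X \<in> Obj C \<Longrightarrow> coproduct_comparison F (incl X)
           \<in> iso (on_obj F (coprod X)) (product_group (UNIV :: nat set) (\<lambda>_. on_obj F X))"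
    and "finite_functorial_seminorm C F N"
    and "homogeneous_functorial_seminorm C F N"
  shows "trivial_functorial_seminorm C F N"
  unfolding trivial_functorial_seminorm_def
proof (intro ballI)
  fix X \<alpha>
  assume X: "X \<in> Obj C" and \<alpha>: "\<alpha> \<in> carrier (on_obj F X)"
  have S: "coprod X \<in> Obj C" and incl_Hom: "incl X d \<in> Hom C X (coprod X)" for d
    using assms(2)[OF X] by (auto simp: is_coproduct_def)
  interpret A: comm_group "on_obj F X"
    using contravariant_functor_Ab.on_obj_comm_group[OF assms(3) X] .
  \<comment> \<open>The multiples of \<alpha> must be unbounded in \<open>d\<close>. The shift by 1
    keeps the exponent positive, so homogeneity, stated for nonzero integers, applies at every
    \<open>d\<close>, including \<open>d = 0\<close>.\<close>
  define v where "v = (\<lambda>d::nat. \<alpha> [^]\<^bsub>on_obj F X\<^esub> (int d + 1))"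
  \<comment> \<open>Extensionality is vacuous over the index set \<open>UNIV\<close>, so only
    closure under integer powers matters.\<close>
  have "v \<in> carrier (product_group (UNIV :: nat set) (\<lambda>_. on_obj F X))"
    using \<alpha> by (auto simp: v_def intro!: PiE_I A.int_pow_closed)
  \<comment> \<open>Surjectivity of the comparison map realises all multiples by a single \<beta>,
    which makes the bound below uniform in \<open>d\<close>.\<close>
  then have "v \<in> coproduct_comparison F (incl X) ` carrier (on_obj F (coprod X))"
    using assms(4)[OF X] unfolding iso_def bij_betw_def by blast
  then obtain \<beta> where \<beta>: "\<beta> \<in> carrier (on_obj F (coprod X))"
    and v: "coproduct_comparison F (incl X) \<beta> = v"
    by blast
  have bound: "(real d + 1) * N X \<alpha> \<le> N (coprod X) \<beta>" for d
  proof -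
    have "N X (v d) = (real d + 1) * N X \<alpha>"
      using assms(6) X \<alpha>
      by (simp add: v_def homogeneous_functorial_seminorm_def homogeneous_seminorm_def)
    moreover have "on_arr F (incl X d) \<beta> = v d"
      using v by (simp add: coproduct_comparison_def fun_eq_iff)
    moreover have "N X (on_arr F (incl X d) \<beta>) \<le> N (coprod X) \<beta>"
      using assms(5) X S incl_Hom \<beta> by (auto simp: finite_functorial_seminorm_def)
    ultimately show ?thesis
      by simp
  qed
  have nonneg: "0 \<le> N X \<alpha>"
    using assms(5) X \<alpha> by (simp add: finite_functorial_seminorm_def finite_seminorm_def)
  show "N X \<alpha> = 0"
  proof (rule ccontr)
    assume "N X \<alpha> \<noteq> 0"
    with nonneg have pos: "0 < N X \<alpha>"
      by simp
    \<comment> \<open>Archimedean property: together with \<open>bound\<close>, this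
      \<open>d\<close> gives \<open>(d + 1) * N X \<alpha> < d * N X \<alpha>\<close>, impossible
      for positive \<open>N X \<alpha>\<close>.\<close>
    then obtain d :: nat where "N (coprod X) \<beta> < real d * N X \<alpha>"
      using reals_Archimedean3 by blast
    with bound[of d] pos show False
      by (simp add: algebra_simps)
  qed
qed

end
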